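(* Let $(M,g)$ be a 3-dimensional Walker manifold with Walker coordinates $(x,y,z)$, in which $$g=\begin{pmatrix}0&0&1\\0&\epsilon&0\\1&0&f\end{pmatrix},\qquad \epsilon=\pm1,$$ with $f=f(x,y,z)$ a smooth function. (1) If $\epsilon=1$, there exist almost paracontact metric structures $(\varphi,\xi,\eta,g)$ on $(M,g)$, which are defined with respect to the local basis $\{\partial_x,\partial_y,\partial_z\}$ as follows: $$\xi=\xi_1\partial_x+\xi_2\partial_y+\xi_3\partial_z,\qquad \eta=\xi_3\,dx+\xi_2\,dy+(\xi_1+f\xi_3)\,dz,$$ $$\varphi=\pm\begin{pmatrix}-\xi_2&\xi_1+f\xi_3&-f\xi_2\\ \xi_3&0&-\xi_1\\0&-\xi_3&\xi_2\end{pmatrix},$$ where $\xi_1,\xi_2,\xi_3$ are smooth functions on $M$ satisfying $\xi_2^2+f\xi_3^2+2\xi_1\xi_3=1$. (That is, for any such functions and either choice of sign, these tensors form an almost paracontact metric structure together with $g$.) (2) If $\epsilon=-1$, there exist no almost paracontact metric structures on $(M,g)$ (with compatible metric $g$).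
   Context: A 3-dimensional Walker manifold is a 3-dimensional pseudo-Riemannian (Lorentzian) manifold $(M,g)$ admitting a parallel lightlike (null) distribution of rank 1. Locally there are coordinates $(x,y,z)$ (Walker coordinates) in which the matrix of $g$ with respect to $\{\partial_x,\partial_y,\partial_z\}$ has the form given in the claim, the null distribution being spanned by $\partial_x$. All statements are with respect to such coordinates. The columns of the matrix of $\varphi$ are the components of $\varphi\partial_x,\varphi\partial_y,\varphi\partial_z$. An almost paracontact metric structure on a $(2n+1)$-dimensional manifold $M$ is a quadruple $(\varphi,\xi,\eta,g)$, where $\varphi$ is an endomorphism of $TM$, $\xi$ a vector field, $\eta$ a 1-form, $g$ a pseudo-Riemannian metric, such that $\varphi^2=\mathrm{Id}-\eta\otimes\xi$, $\eta(\xi)=1$, $\varphi\xi=0$; the $(+1)$- and $(-1)$-eigensubbundles of $\varphi|_{\operatorname{Ker}\eta}$ both have dimension $n$; and $g(\varphi X,\varphi Y)=-g(X,Y)+\eta(X)\eta(Y)$ for all vector fields $X,Y$. Here $n=1$. *)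

theory Defs
  imports "HOL-Analysis.Analysis"
begin

text \<open>
  Everything is expressed in one coordinate chart, identified with an open set \<open>U\<close> of
  \<open>real ^ 'n\<close>. Vector fields and 1-forms are given by their components with respect to the
  coordinate frame and its dual coframe, so \<open>\<eta>(X)\<close> is \<open>\<eta> p \<bullet> X\<close>; endomorphisms and
  metrics are given by their matrices, the columns of the former being the images of the
  coordinate vector fields.
\<close>

text \<open>
  For open \<open>S\<close> in a finite-dimensional space this is the usual notion of class \<open>C\<^sup>k\<close>: all
  iterated directional derivatives up to order \<open>k\<close> exist and are continuous.
\<close>

primrec Ck_on :: "nat \<Rightarrow> 'a set \<Rightarrow> ('a::euclidean_space \<Rightarrow> 'b::real_normed_vector) \<Rightarrow> bool" where
  "Ck_on 0 S h \<longleftrightarrow> continuous_on S h"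
| "Ck_on (Suc k) S h \<longleftrightarrow>
     (\<forall>x\<in>S. h differentiable (at x)) \<and>
     (\<forall>v. Ck_on k S (\<lambda>x. frechet_derivative h (at x) v))"

definition smooth_on :: "'a set \<Rightarrow> ('a::euclidean_space \<Rightarrow> 'b::real_normed_vector) \<Rightarrow> bool" where
  "smooth_on S h \<longleftrightarrow> (\<forall>k. Ck_on k S h)"

definition metric_form :: "real ^ 'n ^ 'n \<Rightarrow> real ^ 'n \<Rightarrow> real ^ 'n \<Rightarrow> real" where
  "metric_form G v w = v \<bullet> (G *v w)"

text \<open>
  No constancy of the signature is imposed: it is automatic on connected \<open>U\<close>, and for metrics
  compatible with an almost paracontact structure the signature is \<open>(n + 1, n)\<close> at every point.
\<close>

definition pseudo_riemannian_metric_on ::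
    "(real ^ 'n) set \<Rightarrow> (real ^ 'n \<Rightarrow> real ^ 'n ^ 'n) \<Rightarrow> bool" where
  "pseudo_riemannian_metric_on U g \<longleftrightarrow>
     smooth_on U g \<and>
     (\<forall>p\<in>U. (\<forall>v w. metric_form (g p) v w = metric_form (g p) w v) \<and>
             (\<forall>v. (\<forall>w. metric_form (g p) v w = 0) \<longrightarrow> v = 0))"

definition almost_paracontact_metric_structure ::
    "nat \<Rightarrow> (real ^ 'n) set \<Rightarrow> (real ^ 'n \<Rightarrow> real ^ 'n ^ 'n) \<Rightarrow> (real ^ 'n \<Rightarrow> real ^ 'n) \<Rightarrow>
     (real ^ 'n \<Rightarrow> real ^ 'n) \<Rightarrow> (real ^ 'n \<Rightarrow> real ^ 'n ^ 'n) \<Rightarrow> bool" where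
  "almost_paracontact_metric_structure n U \<phi> \<xi> \<eta> g \<longleftrightarrow>
     CARD('n) = 2 * n + 1 \<and>
     smooth_on U \<phi> \<and> smooth_on U \<xi> \<and> smooth_on U \<eta> \<and>
     pseudo_riemannian_metric_on U g \<and>
     (\<forall>p\<in>U.
        (\<forall>v. \<phi> p *v (\<phi> p *v v) = v - (\<eta> p \<bullet> v) *\<^sub>R \<xi> p) \<and>
        \<eta> p \<bullet> \<xi> p = 1 \<and>
        \<phi> p *v \<xi> p = 0 \<and>
        dim {v. \<eta> p \<bullet> v = 0 \<and> \<phi> p *v v = v} = n \<and>
        dim {v. \<eta> p \<bullet> v = 0 \<and> \<phi> p *v v = - v} = n) \<and>
     (\<forall>X Y. smooth_on U X \<longrightarrow> smooth_on U Y \<longrightarrow>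
        (\<forall>p\<in>U. metric_form (g p) (\<phi> p *v X p) (\<phi> p *v Y p) =
                - metric_form (g p) (X p) (Y p) + (\<eta> p \<bullet> X p) * (\<eta> p \<bullet> Y p)))"

definition walker_metric :: "real \<Rightarrow> (real ^ 3 \<Rightarrow> real) \<Rightarrow> real ^ 3 \<Rightarrow> real ^ 3 ^ 3" where
  "walker_metric \<epsilon> f p = vector [vector [0, 0, 1],
                                  vector [0, \<epsilon>, 0],
                                  vector [1, 0, f p]]"

definition walker_xi ::
    "(real ^ 3 \<Rightarrow> real) \<Rightarrow> (real ^ 3 \<Rightarrow> real) \<Rightarrow> (real ^ 3 \<Rightarrow> real) \<Rightarrow> real ^ 3 \<Rightarrow> real ^ 3" where
  "walker_xi \<xi>1 \<xi>2 \<xi>3 p = vector [\<xi>1 p, \<xi>2 p, \<xi>3 p]"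

definition walker_eta ::
    "(real ^ 3 \<Rightarrow> real) \<Rightarrow> (real ^ 3 \<Rightarrow> real) \<Rightarrow> (real ^ 3 \<Rightarrow> real) \<Rightarrow> (real ^ 3 \<Rightarrow> real) \<Rightarrow>
     real ^ 3 \<Rightarrow> real ^ 3" where
  "walker_eta f \<xi>1 \<xi>2 \<xi>3 p = vector [\<xi>3 p, \<xi>2 p, \<xi>1 p + f p * \<xi>3 p]"

text \<open>The argument \<open>s\<close> is the overall sign, \<open>1\<close> or \<open>- 1\<close>.\<close>

definition walker_phi ::
    "real \<Rightarrow> (real ^ 3 \<Rightarrow> real) \<Rightarrow> (real ^ 3 \<Rightarrow> real) \<Rightarrow> (real ^ 3 \<Rightarrow> real) \<Rightarrow> (real ^ 3 \<Rightarrow> real) \<Rightarrow>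
     real ^ 3 \<Rightarrow> real ^ 3 ^ 3" where
  "walker_phi s f \<xi>1 \<xi>2 \<xi>3 p =
     s *\<^sub>R vector [vector [- \<xi>2 p, \<xi>1 p + f p * \<xi>3 p, - f p * \<xi>2 p],
                  vector [\<xi>3 p, 0, - \<xi>1 p],
                  vector [0, - \<xi>3 p, \<xi>2 p]]"

end

theory Submission imports Defs begin

text \<open>
  For \<open>\<epsilon> = 1\<close> everything is pointwise algebra: the normalisation of \<open>\<xi>\<close> makes each eigenspace of
  \<open>\<phi>\<close> in \<open>ker \<eta>\<close> a line, and replacing \<open>\<xi>\<close> by \<open>- \<xi>\<close> exchanges the two. Existence follows
  by taking \<open>\<xi> = \<partial>\<^sub>y\<close>.

  For \<open>\<epsilon> = - 1\<close> the metric has signature \<open>(1, 2)\<close>. Compatibility gives \<open>\<eta> = g(\<xi>, -)\<close>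
  and \<open>g(\<xi>, \<xi>) = 1\<close>, so \<open>g\<close> is negative definite on \<open>ker \<eta>\<close>; but it also forces every
  eigenvector of \<open>\<phi>\<close> in \<open>ker \<eta>\<close> to be null.
\<close>

subsection \<open>Smooth functions\<close>

text \<open>Openness makes a derivative at a point of \<open>S\<close> depend only on values in
  \<open>S\<close>. The closure proofs below rely on this, since their formulas for
  \<open>frechet_derivative\<close> are known on \<open>S\<close> only, not as equalities of
  functions.\<close>

lemma Ck_on_cong:
  assumes "open S" "\<And>x. x \<in> S \<Longrightarrow> h x = k x" "Ck_on n S h"
  shows "Ck_on n S k"
  using assms(2,3)
proof (induction n arbitrary: h k)
  case 0
  then show ?case using continuous_on_cong[of S S h k] by simp
next
  case (Suc n)
  have der: "(k has_derivative frechet_derivative h (at x)) (at x)" if "x \<in> S" for x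
  proof (rule has_derivative_transform_within_open[OF _ \<open>open S\<close> that])
    show "(h has_derivative frechet_derivative h (at x)) (at x)"
      using Suc.prems that by (simp add: frechet_derivative_works[symmetric])
  qed (use Suc.prems in auto)
  have eq: "frechet_derivative h (at x) = frechet_derivative k (at x)" if "x \<in> S" for x
    using frechet_derivative_at[OF der[OF that]] .
  have "Ck_on n S (\<lambda>x. frechet_derivative k (at x) v)" for v
    by (rule Suc.IH[where h = "\<lambda>x. frechet_derivative h (at x) v"]) (use eq Suc.prems in auto)
  then show ?case using der by (auto simp: differentiable_def)
qed

text \<open>The product rule leaves one factor undifferentiated; the induction for
  \<open>Ck_on_mult\<close> has to lower the regularity of that factor by one.\<close>

lemma Ck_on_mono_Suc: "Ck_on (Suc n) S h \<Longrightarrow> Ck_on n S h"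
proof (induction n arbitrary: h)
  case 0
  then show ?case
    by (auto intro!: continuous_at_imp_continuous_on differentiable_imp_continuous_within)
next
  case (Suc n)
  then show ?case by (metis Ck_on.simps(2))
qed

lemma Ck_on_const: "Ck_on n S (\<lambda>x. c)"
  by (induction n arbitrary: c) (auto simp: frechet_derivative_const)

text \<open>A fixed linear map commutes with directional derivatives, so the induction reproduces
  itself.\<close>

lemma Ck_on_bounded_linear:
  assumes "open S" "bounded_linear L" "Ck_on n S h"
  shows "Ck_on n S (\<lambda>x. L (h x))"
  using assms(3)
proof (induction n arbitrary: h)
  case 0
  then show ?case using linear_continuous_on_compose bounded_linear.continuous_on[OF assms(2)]
    by auto
next
  case (Suc n)
  have der: "((\<lambda>x. L (h x)) has_derivative (\<lambda>v. L (frechet_derivative h (at x) v))) (at x)"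
    if "x \<in> S" for x
    using Suc.prems that
    by (intro bounded_linear.has_derivative[OF assms(2)])
      (auto simp: frechet_derivative_works[symmetric])
  have "Ck_on n S (\<lambda>x. frechet_derivative (\<lambda>x. L (h x)) (at x) v)" for v
    by (rule Ck_on_cong[OF \<open>open S\<close> _ Suc.IH[of "\<lambda>x. frechet_derivative h (at x) v"]])
      (use Suc.prems frechet_derivative_at[OF der] in \<open>auto simp: fun_eq_iff\<close>)
  then show ?case using der by (auto simp: differentiable_def)
qed

lemma Ck_on_add:
  assumes "open S" "Ck_on n S h" "Ck_on n S k"
  shows "Ck_on n S (\<lambda>x. h x + k x)"
  using assms(2,3)
proof (induction n arbitrary: h k)
  case 0
  then show ?case by (auto intro: continuous_intros)
next
  case (Suc n)
  have der: "((\<lambda>x. h x + k x) has_derivative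
      (\<lambda>v. frechet_derivative h (at x) v + frechet_derivative k (at x) v)) (at x)"
    if "x \<in> S" for x
    using Suc.prems that
    by (intro has_derivative_add) (auto simp: frechet_derivative_works[symmetric])
  have "Ck_on n S (\<lambda>x. frechet_derivative (\<lambda>x. h x + k x) (at x) v)" for v
    by (rule Ck_on_cong[OF \<open>open S\<close> _ Suc.IH[of "\<lambda>x. frechet_derivative h (at x) v"
            "\<lambda>x. frechet_derivative k (at x) v"]])
      (use Suc.prems frechet_derivative_at[OF der] in \<open>auto simp: fun_eq_iff\<close>)
  then show ?case using der by (auto simp: differentiable_def)
qed

lemma Ck_on_mult:
  fixes h k :: "'a::euclidean_space \<Rightarrow> 'b::real_normed_algebra"
  assumes "open S" "Ck_on n S h" "Ck_on n S k"
  shows "Ck_on n S (\<lambda>x. h x * k x)"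
  using assms(2,3)
proof (induction n arbitrary: h k)
  case 0
  then show ?case by (auto intro: continuous_intros)
next
  case (Suc n)
  have der: "((\<lambda>x. h x * k x) has_derivative
      (\<lambda>v. h x * frechet_derivative k (at x) v + frechet_derivative h (at x) v * k x)) (at x)"
    if "x \<in> S" for x
    using Suc.prems that
    by (intro has_derivative_mult) (auto simp: frechet_derivative_works[symmetric])
  have "Ck_on n S (\<lambda>x. h x * frechet_derivative k (at x) v + frechet_derivative h (at x) v * k x)"
    for v
    using Suc.prems Suc.prems[THEN Ck_on_mono_Suc]
    by (intro Ck_on_add[OF \<open>open S\<close>] Suc.IH) auto
  then have "Ck_on n S (\<lambda>x. frechet_derivative (\<lambda>x. h x * k x) (at x) v)" for v
    by (rule Ck_on_cong[OF \<open>open S\<close>, rotated])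
      (use frechet_derivative_at[OF der] in \<open>auto simp: fun_eq_iff\<close>)
  then show ?case using der by (auto simp: differentiable_def)
qed

lemma smooth_on_const: "smooth_on S (\<lambda>x. c)"
  by (simp add: smooth_on_def Ck_on_const)

lemma smooth_on_bounded_linear:
  "open S \<Longrightarrow> bounded_linear L \<Longrightarrow> smooth_on S h \<Longrightarrow> smooth_on S (\<lambda>x. L (h x))"
  by (simp add: smooth_on_def Ck_on_bounded_linear)

lemma smooth_on_add:
  "open S \<Longrightarrow> smooth_on S h \<Longrightarrow> smooth_on S k \<Longrightarrow> smooth_on S (\<lambda>x. h x + k x)"
  by (simp add: smooth_on_def Ck_on_add)

lemma smooth_on_mult:
  fixes h k :: "'a::euclidean_space \<Rightarrow> 'b::real_normed_algebra"
  shows "open S \<Longrightarrow> smooth_on S h \<Longrightarrow> smooth_on S k \<Longrightarrow> smooth_on S (\<lambda>x. h x * k x)"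
  by (simp add: smooth_on_def Ck_on_mult)

lemma smooth_on_scaleR:
  "open S \<Longrightarrow> smooth_on S h \<Longrightarrow> smooth_on S (\<lambda>x. c *\<^sub>R h x)"
  by (rule smooth_on_bounded_linear[OF _ bounded_linear_scaleR_right])

lemma smooth_on_minus:
  "open S \<Longrightarrow> smooth_on S h \<Longrightarrow> smooth_on S (\<lambda>x. - h x)"
  using smooth_on_scaleR[of S h "- 1"] by simp

lemma bounded_linear_axis: "bounded_linear (axis i :: 'b::euclidean_space \<Rightarrow> 'b ^ 'n)"
  unfolding linear_conv_bounded_linear[symmetric]
  by (rule linearI) (simp_all add: vec_eq_iff axis_def)

text \<open>The vector is a sum of images of its entries under linear inclusions. The entry type is
  left general so that the same lemma assembles matrices from their rows.\<close>

lemma smooth_on_vector3: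
  fixes a b c :: "'a::euclidean_space \<Rightarrow> 'b::euclidean_space"
  assumes "open S" "smooth_on S a" "smooth_on S b" "smooth_on S c"
  shows "smooth_on S (\<lambda>x. vector [a x, b x, c x] :: 'b ^ 3)"
proof -
  have "(\<lambda>x. vector [a x, b x, c x] :: 'b ^ 3) = (\<lambda>x. axis 1 (a x) + axis 2 (b x) + axis 3 (c x))"
    by (simp add: fun_eq_iff vec_eq_iff forall_3 axis_def)
  then show ?thesis
    using assms
    by (simp add: smooth_on_add smooth_on_bounded_linear[OF _ bounded_linear_axis])
qed

lemmas smooth_on_intros =
  smooth_on_const smooth_on_add smooth_on_mult smooth_on_minus smooth_on_scaleR smooth_on_vector3

subsection \<open>Walker metrics\<close>

lemmas vec3_simps =
  matrix_vector_mult_def vec_eq_iff forall_3 sum_3 inner_vec_def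

lemma metric_form_walker:
  "metric_form (walker_metric \<epsilon> f p) v w =
     v $ 1 * w $ 3 + v $ 3 * w $ 1 + \<epsilon> * (v $ 2 * w $ 2) + f p * (v $ 3 * w $ 3)"
  by (simp add: metric_form_def walker_metric_def vec3_simps algebra_simps)

lemma pseudo_riemannian_walker_metric:
  assumes "open U" "smooth_on U f" "\<epsilon> \<noteq> 0"
  shows "pseudo_riemannian_metric_on U (walker_metric \<epsilon> f)"
  unfolding pseudo_riemannian_metric_on_def
proof (intro conjI ballI allI impI)
  show "smooth_on U (walker_metric \<epsilon> f)"
    unfolding walker_metric_def[abs_def] using assms by (intro smooth_on_intros)
next
  fix p v w
  show "metric_form (walker_metric \<epsilon> f p) v w = metric_form (walker_metric \<epsilon> f p) w v"
    by (simp add: metric_form_walker algebra_simps)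
next
  fix p v
  assume "\<forall>w. metric_form (walker_metric \<epsilon> f p) v w = 0"
  then have "metric_form (walker_metric \<epsilon> f p) v (axis i 1) = 0" for i
    by blast
  \<comment> \<open>The three pairings are \<open>v $ 3\<close>, \<open>\<epsilon> * v $ 2\<close>
    and \<open>v $ 1 + f p * v $ 3\<close>.\<close>
  from this[of 1] this[of 2] this[of 3] show "v = 0"
    using \<open>\<epsilon> \<noteq> 0\<close> by (simp add: metric_form_walker axis_def vec_eq_iff forall_3)
qed

lemma walker_phi_mult:
  "walker_phi s f \<xi>1 \<xi>2 \<xi>3 p *v v =
     s *\<^sub>R vector [- \<xi>2 p * v $ 1 + (\<xi>1 p + f p * \<xi>3 p) * v $ 2 - f p * \<xi>2 p * v $ 3,
                  \<xi>3 p * v $ 1 - \<xi>1 p * v $ 3, - \<xi>3 p * v $ 2 + \<xi>2 p * v $ 3]"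
  by (simp add: walker_phi_def vec3_simps algebra_simps)

lemma walker_eta_inner:
  "walker_eta f \<xi>1 \<xi>2 \<xi>3 p \<bullet> v = \<xi>3 p * v $ 1 + \<xi>2 p * v $ 2 + (\<xi>1 p + f p * \<xi>3 p) * v $ 3"
  by (simp add: walker_eta_def vec3_simps)

text \<open>With \<open>a\<close>, \<open>b\<close>, \<open>c\<close> the components of
  \<open>\<xi>\<close>, this is the eigenspace for the eigenvalue 1 of \<open>walker_phi\<close>
  with sign 1, inside the kernel of \<open>\<eta>\<close>. An explicit spanning vector is found in
  each case. The other eigenvalue and sign reduce to this one by negating \<open>a\<close>,
  \<open>b\<close>, \<open>c\<close>, which preserves \<open>unit\<close>.\<close>

lemma walker_eigenspace_dim:
  fixes a b c f :: real
  assumes unit: "b\<^sup>2 + f * c\<^sup>2 + 2 * a * c = 1"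
  shows "dim {v :: real ^ 3. c * v $ 1 + b * v $ 2 + (a + f * c) * v $ 3 = 0 \<and>
     - b * v $ 1 + (a + f * c) * v $ 2 - f * b * v $ 3 = v $ 1 \<and>
     c * v $ 1 - a * v $ 3 = v $ 2 \<and> - c * v $ 2 + b * v $ 3 = v $ 3} = 1" (is "dim ?E = 1")
proof -
  have "\<exists>w. w \<noteq> 0 \<and> w \<in> ?E \<and> ?E \<subseteq> span {w}"
  proof (cases "c = 0")
    case False
    \<comment> \<open>This solves the last two equations of \<open>?E\<close> with the third entry
      set to \<open>c\<^sup>2\<close>; \<open>unit\<close> then yields the first two
      equations.\<close>
    let ?w = "vector [b - 1 + a * c, c * (b - 1), c\<^sup>2] :: real ^ 3"
    have "v \<in> span {?w}" if "v \<in> ?E" for v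
    proof -
      have e: "c * v $ 1 = v $ 2 + a * v $ 3" "c * v $ 2 = (b - 1) * v $ 3"
        using that by (auto simp: algebra_simps)
      have "c\<^sup>2 * v $ 1 = c * (c * v $ 1)" by (simp add: power2_eq_square)
      also have "\<dots> = (b - 1 + a * c) * v $ 3"
        unfolding e(1) using e(2) by (simp add: algebra_simps)
      finally have "c\<^sup>2 * v $ 1 = (b - 1 + a * c) * v $ 3" .
      moreover have "c\<^sup>2 * v $ 2 = c * (b - 1) * v $ 3"
        using e(2) by (simp add: power2_eq_square)
      ultimately have "v = (v $ 3 / c\<^sup>2) *\<^sub>R ?w"
        using False by (simp add: vec_eq_iff forall_3 field_simps power2_eq_square)
      then show ?thesis by (metis span_base span_scale singletonI)
    qed
    moreover have "?w \<in> ?E"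
      using unit by (simp; algebra)
    moreover have "?w \<noteq> 0" using False by (simp add: vec_eq_iff forall_3)
    ultimately show ?thesis by blast
  next
    case True
    with unit have "b = 1 \<or> b = - 1" by (simp add: power2_eq_1_iff)
    then show ?thesis
    proof
      assume b: "b = 1"
      \<comment> \<open>Setting the third entry to 1, the third equation gives the second entry and
        the second equation gives the first.\<close>
      let ?w = "vector [- (a\<^sup>2 + f) / 2, - a, 1] :: real ^ 3"
      have "v = (v $ 3) *\<^sub>R ?w" if "v \<in> ?E" for v
      proof -
        have e: "v $ 2 = - a * v $ 3" "2 * v $ 1 = a * v $ 2 - f * v $ 3"
          using that True b by auto
        have "2 * v $ 1 = - (a\<^sup>2 + f) * v $ 3"
          unfolding e by (simp add: algebra_simps power2_eq_square)
        with e(1) show ?thesis by (simp add: vec_eq_iff forall_3 field_simps)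
      qed
      then have "?E \<subseteq> span {?w}"
        unfolding span_singleton by blast
      moreover have "?w \<in> ?E"
        using True b by (simp add: field_simps power2_eq_square)
      moreover have "?w \<noteq> 0" by (simp add: vec_eq_iff forall_3)
      ultimately show ?thesis by blast
    next
      assume b: "b = - 1"
      \<comment> \<open>The last equation now reads \<open>- v $ 3 = v $ 3\<close>, so
        \<open>v $ 3\<close> and then \<open>v $ 2\<close> vanish, leaving the null direction of the
        Walker coordinates.\<close>
      let ?w = "vector [1, 0, 0] :: real ^ 3"
      have "v = (v $ 1) *\<^sub>R ?w" if "v \<in> ?E" for v
        using that True b by (auto simp: vec_eq_iff forall_3)
      then have "?E \<subseteq> span {?w}"
        unfolding span_singleton by blast
      moreover have "?w \<in> ?E"
        using True b by simp
      moreover have "?w \<noteq> 0" by (simp add: vec_eq_iff forall_3)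
      ultimately show ?thesis by blast
    qed
  qed
  then obtain w where w: "w \<noteq> 0" "w \<in> ?E" "?E \<subseteq> span {w}" by blast
  have "dim {w} \<le> dim ?E" by (rule dim_subset) (use w(2) in blast)
  moreover have "dim ?E \<le> dim (span {w})" by (rule dim_subset) (rule w(3))
  ultimately show ?thesis using w(1) by simp
qed

text \<open>Apart from smoothness and the eigenspace dimensions, every axiom on the tensors is a
  polynomial identity at each point modulo the relation \<open>unit\<close>.\<close>

lemma almost_paracontact_walker:
  assumes "open U" "smooth_on U f" "smooth_on U \<xi>1" "smooth_on U \<xi>2" "smooth_on U \<xi>3"
    and unit: "\<And>p. p \<in> U \<Longrightarrow> (\<xi>2 p)\<^sup>2 + f p * (\<xi>3 p)\<^sup>2 + 2 * \<xi>1 p * \<xi>3 p = 1"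
    and s: "s = 1 \<or> s = - 1"
  shows "almost_paracontact_metric_structure 1 U (walker_phi s f \<xi>1 \<xi>2 \<xi>3)
    (walker_xi \<xi>1 \<xi>2 \<xi>3) (walker_eta f \<xi>1 \<xi>2 \<xi>3) (walker_metric 1 f)"
  unfolding almost_paracontact_metric_structure_def
proof (intro conjI ballI allI impI)
  show "smooth_on U (walker_phi s f \<xi>1 \<xi>2 \<xi>3)" "smooth_on U (walker_xi \<xi>1 \<xi>2 \<xi>3)"
    "smooth_on U (walker_eta f \<xi>1 \<xi>2 \<xi>3)"
    unfolding walker_phi_def[abs_def] walker_xi_def[abs_def] walker_eta_def[abs_def]
    by (intro smooth_on_intros assms(1-5))+
  show "pseudo_riemannian_metric_on U (walker_metric 1 f)"
    using assms by (intro pseudo_riemannian_walker_metric) auto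
next
  fix p assume p: "p \<in> U"
  let ?\<phi> = "walker_phi s f \<xi>1 \<xi>2 \<xi>3 p" and ?\<eta> = "walker_eta f \<xi>1 \<xi>2 \<xi>3 p"
  note u = unit[OF p]
  show "?\<phi> *v (?\<phi> *v v) = v - (?\<eta> \<bullet> v) *\<^sub>R walker_xi \<xi>1 \<xi>2 \<xi>3 p" for v
    using s u unfolding walker_phi_mult walker_eta_inner walker_xi_def
    by (elim disjE; simp add: vec_eq_iff forall_3; intro conjI; algebra)
  show "?\<eta> \<bullet> walker_xi \<xi>1 \<xi>2 \<xi>3 p = 1"
    using u unfolding walker_eta_inner walker_xi_def
    by (simp add: algebra_simps power2_eq_square)
  show "?\<phi> *v walker_xi \<xi>1 \<xi>2 \<xi>3 p = 0"
    unfolding walker_phi_mult walker_xi_def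
    by (simp add: vec_eq_iff forall_3 algebra_simps)
  have eig: "dim {v. ?\<eta> \<bullet> v = 0 \<and> ?\<phi> *v v = r *\<^sub>R v} = 1" if r: "r = 1 \<or> r = - 1" for r
  proof -
    \<comment> \<open>Since \<open>r\<close> and \<open>s\<close> are signs, the eigenvector
      equation depends only on their product. As \<open>walker_phi\<close> and
      \<open>walker_eta\<close> are linear in \<open>\<xi>\<close>, the factor \<open>t\<close> can
      be absorbed into \<open>\<xi>\<close>, and \<open>unit\<close> survives because the square of
      \<open>t\<close> is 1.\<close>
    define t where "t = r * s"
    have t: "t = 1 \<or> t = - 1" using r s by (auto simp: t_def)
    have "{v. ?\<eta> \<bullet> v = 0 \<and> ?\<phi> *v v = r *\<^sub>R v} =
      {v. (t * \<xi>3 p) * v $ 1 + (t * \<xi>2 p) * v $ 2 + (t * \<xi>1 p + f p * (t * \<xi>3 p)) * v $ 3 = 0 \<and>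
       - (t * \<xi>2 p) * v $ 1 + (t * \<xi>1 p + f p * (t * \<xi>3 p)) * v $ 2 - f p * (t * \<xi>2 p) * v $ 3
         = v $ 1 \<and>
       (t * \<xi>3 p) * v $ 1 - (t * \<xi>1 p) * v $ 3 = v $ 2 \<and>
       - (t * \<xi>3 p) * v $ 2 + (t * \<xi>2 p) * v $ 3 = v $ 3}"
      unfolding walker_phi_mult walker_eta_inner t_def using r s
      by (elim disjE; simp add: vec_eq_iff forall_3; intro Collect_cong; argo)
    also have "dim \<dots> = 1"
      using t u by (intro walker_eigenspace_dim) auto
    finally show ?thesis .
  qed
  show "dim {v. ?\<eta> \<bullet> v = 0 \<and> ?\<phi> *v v = v} = 1" "dim {v. ?\<eta> \<bullet> v = 0 \<and> ?\<phi> *v v = - v} = 1"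
    using eig[of 1] eig[of "- 1"] by simp_all
  fix X Y :: "real ^ 3 \<Rightarrow> real ^ 3"
  show "metric_form (walker_metric 1 f p) (?\<phi> *v X p) (?\<phi> *v Y p) =
      - metric_form (walker_metric 1 f p) (X p) (Y p) + (?\<eta> \<bullet> X p) * (?\<eta> \<bullet> Y p)"
    using s u unfolding walker_phi_mult walker_eta_inner metric_form_walker
    by (elim disjE; simp; algebra)
qed simp

text \<open>After multiplying \<open>g(v, v) = 0\<close> by \<open>c\<^sup>2\<close> and eliminating \<open>c * v1\<close>, the left-hand side is minus
  a sum of two squares.\<close>

lemma neg_definite_orthogonal:
  fixes a b c f v1 v2 v3 :: real
  assumes "2 * a * c - b\<^sup>2 + f * c\<^sup>2 = 1"
    and "a * v3 + c * v1 - b * v2 + f * (c * v3) = 0"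
    and "2 * v1 * v3 - v2\<^sup>2 + f * v3\<^sup>2 = 0"
  shows "v1 = 0 \<and> v2 = 0 \<and> v3 = 0"
proof -
  \<comment> \<open>A vector with \<open>c = 0\<close> has square norm \<open>- b\<^sup>2\<close>,
    which cannot be 1. This is also what later allows \<open>v1\<close> and \<open>v2\<close> to be
    recovered.\<close>
  have "c \<noteq> 0"
  proof
    assume "c = 0"
    with assms(1) have "- b\<^sup>2 = 1" by simp
    then show False using zero_le_power2[of b] by linarith
  qed
  have "(b * v3 - c * v2)\<^sup>2 + v3\<^sup>2 = 0"
    using assms by algebra
  then have "v3 = 0" "c * v2 = 0"
    by (auto simp: sum_power2_eq_zero_iff)
  with \<open>c \<noteq> 0\<close> assms(2) show ?thesis by simp
qed

text \<open>The contradiction arises at a single point; on an empty \<open>U\<close> the pointwise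
  axioms would hold vacuously.\<close>

lemma no_almost_paracontact_walker:
  assumes "U \<noteq> {}"
  shows "\<not> almost_paracontact_metric_structure 1 U \<phi> \<xi> \<eta> (walker_metric (- 1) f)"
proof
  assume A: "almost_paracontact_metric_structure 1 U \<phi> \<xi> \<eta> (walker_metric (- 1) f)"
  obtain p where p: "p \<in> U" using assms by blast
  let ?g = "metric_form (walker_metric (- 1) f p)"
  \<comment> \<open>Compatibility is stated for smooth vector fields; constant fields bring it down
    to arbitrary vectors at \<open>p\<close>.\<close>
  have comp: "?g (\<phi> p *v v) (\<phi> p *v w) = - ?g v w + (\<eta> p \<bullet> v) * (\<eta> p \<bullet> w)" for v w
  proof -
    have "\<forall>X Y. smooth_on U X \<longrightarrow> smooth_on U Y \<longrightarrow>
        (\<forall>p\<in>U. metric_form (walker_metric (- 1) f p) (\<phi> p *v X p) (\<phi> p *v Y p) =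
                - metric_form (walker_metric (- 1) f p) (X p) (Y p) + (\<eta> p \<bullet> X p) * (\<eta> p \<bullet> Y p))"
      using A unfolding almost_paracontact_metric_structure_def by blast
    from this[rule_format, of "\<lambda>_. v" "\<lambda>_. w", OF smooth_on_const smooth_on_const p]
    show ?thesis .
  qed
  have \<xi>: "\<eta> p \<bullet> \<xi> p = 1" "\<phi> p *v \<xi> p = 0"
    and dim: "dim {v. \<eta> p \<bullet> v = 0 \<and> \<phi> p *v v = v} = 1"
    using A p unfolding almost_paracontact_metric_structure_def by blast+
  have "\<not> {v. \<eta> p \<bullet> v = 0 \<and> \<phi> p *v v = v} \<subseteq> {0}"
  proof
    assume "{v. \<eta> p \<bullet> v = 0 \<and> \<phi> p *v v = v} \<subseteq> {0}"
    from dim_subset[OF this] show False unfolding dim by simp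
  qed
  then obtain v where v: "v \<noteq> 0" "\<eta> p \<bullet> v = 0" "\<phi> p *v v = v"
    by blast
  have g0: "?g 0 w = 0" for w
    by (simp add: metric_form_def)
  \<comment> \<open>Since \<open>\<phi>\<close> kills \<open>\<xi>\<close>, the first two left-hand
    sides of \<open>comp\<close> vanish. For the eigenvector, \<open>comp\<close> says that
    \<open>?g v v\<close> equals its own negative.\<close>
  have "?g (\<xi> p) (\<xi> p) = 1" "?g (\<xi> p) v = 0" "?g v v = 0"
    using comp[of "\<xi> p" "\<xi> p"] comp[of "\<xi> p" v] comp[of v v] \<xi> v by (simp_all add: g0)
  then have "v $ 1 = 0 \<and> v $ 2 = 0 \<and> v $ 3 = 0"
    \<comment> \<open>The instantiation follows the order of first occurrence in that lemma:
      \<open>a\<close>, \<open>c\<close>, \<open>b\<close>, \<open>f\<close>.\<close>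
    by (intro neg_definite_orthogonal[of "\<xi> p $ 1" "\<xi> p $ 3" "\<xi> p $ 2" "f p"])
      (simp_all add: metric_form_walker algebra_simps power2_eq_square)
  then show False using v(1) by (simp add: vec_eq_iff forall_3)
qed

theorem theorem3p1:
  fixes U :: "(real ^ 3) set" and f :: "real ^ 3 \<Rightarrow> real" and \<epsilon> :: real
  assumes "open U" and "U \<noteq> {}"
    and "smooth_on U f"
    and "\<epsilon> = 1 \<or> \<epsilon> = - 1"
  shows "(\<epsilon> = 1 \<longrightarrow>
            (\<forall>\<xi>1 \<xi>2 \<xi>3 s.
               smooth_on U \<xi>1 \<and> smooth_on U \<xi>2 \<and> smooth_on U \<xi>3 \<and>
               (\<forall>p\<in>U. (\<xi>2 p)^2 + f p * (\<xi>3 p)^2 + 2 * \<xi>1 p * \<xi>3 p = 1) \<and>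
               (s = 1 \<or> s = - 1) \<longrightarrow>
               almost_paracontact_metric_structure 1 U
                 (walker_phi s f \<xi>1 \<xi>2 \<xi>3) (walker_xi \<xi>1 \<xi>2 \<xi>3) (walker_eta f \<xi>1 \<xi>2 \<xi>3)
                 (walker_metric \<epsilon> f)) \<and>
            (\<exists>\<phi> \<xi> \<eta>. almost_paracontact_metric_structure 1 U \<phi> \<xi> \<eta> (walker_metric \<epsilon> f))) \<and>
         (\<epsilon> = - 1 \<longrightarrow>
            \<not> (\<exists>\<phi> \<xi> \<eta>. almost_paracontact_metric_structure 1 U \<phi> \<xi> \<eta> (walker_metric \<epsilon> f)))"
proof (intro conjI impI)
  assume "\<epsilon> = 1"
  then show "\<forall>\<xi>1 \<xi>2 \<xi>3 s.
      smooth_on U \<xi>1 \<and> smooth_on U \<xi>2 \<and> smooth_on U \<xi>3 \<and>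
      (\<forall>p\<in>U. (\<xi>2 p)^2 + f p * (\<xi>3 p)^2 + 2 * \<xi>1 p * \<xi>3 p = 1) \<and> (s = 1 \<or> s = - 1) \<longrightarrow>
      almost_paracontact_metric_structure 1 U (walker_phi s f \<xi>1 \<xi>2 \<xi>3)
        (walker_xi \<xi>1 \<xi>2 \<xi>3) (walker_eta f \<xi>1 \<xi>2 \<xi>3) (walker_metric \<epsilon> f)"
    using assms by (blast intro: almost_paracontact_walker)
  \<comment> \<open>This constant choice satisfies the normalisation for every \<open>f\<close>,
    since both terms containing \<open>\<xi>3\<close> vanish.\<close>
  have "almost_paracontact_metric_structure 1 U (walker_phi 1 f (\<lambda>_. 0) (\<lambda>_. 1) (\<lambda>_. 0))
      (walker_xi (\<lambda>_. 0) (\<lambda>_. 1) (\<lambda>_. 0)) (walker_eta f (\<lambda>_. 0) (\<lambda>_. 1) (\<lambda>_. 0))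
      (walker_metric \<epsilon> f)"
    unfolding \<open>\<epsilon> = 1\<close> using assms by (intro almost_paracontact_walker smooth_on_const) auto
  then show "\<exists>\<phi> \<xi> \<eta>. almost_paracontact_metric_structure 1 U \<phi> \<xi> \<eta> (walker_metric \<epsilon> f)"
    by blast
next
  assume "\<epsilon> = - 1"
  then show "\<not> (\<exists>\<phi> \<xi> \<eta>. almost_paracontact_metric_structure 1 U \<phi> \<xi> \<eta> (walker_metric \<epsilon> f))"
    using assms no_almost_paracontact_walker by blast
qed

end
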